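(* Let $R$ be a noetherian commutative ring with identity. Then $R$ is an MTL-ring if and only if $R$ is a BL-ring.
   Context: For ideals $I,J$ of a commutative ring $R$, write $I\rightarrow J=\{x\in R : xI\subseteq J\}$. A commutative ring $R$ such that for every $x\in R$ there is $r\in R$ with $x=rx$ (automatic if $R$ has an identity) is called an MTL-ring if $(I\rightarrow J)+(J\rightarrow I)=R$ for all ideals $I,J$ of $R$. It is called a BL-ring if its ideals form a BL-algebra (with meet $\cap$, join $+$, product of ideals, and residuum $\rightarrow$), i.e. if it is an MTL-ring and moreover $I\cap J=I\cdot(I\rightarrow J)$ for all ideals $I,J$ of $R$. *)

theory Defs
  imports "HOL-Algebra.Algebra"
begin

definition ideal_residuum :: "('a, 'b) ring_scheme \<Rightarrow> 'a set \<Rightarrow> 'a set \<Rightarrow> 'a set"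
  where "ideal_residuum R I J = {x \<in> carrier R. x <#\<^bsub>R\<^esub> I \<subseteq> J}"

text \<open>
  Rings in HOL-Algebra have an identity, so \<open>local_unit\<close>, which in the literature replaces
  the identity, is redundant here; it is kept so that the definition reads as usual.
\<close>

locale MTL_ring = cring R for R (structure) +
  assumes local_unit: "x \<in> carrier R \<Longrightarrow> \<exists>r\<in>carrier R. x = r \<otimes> x"
    and prelinear: "\<lbrakk>ideal I R; ideal J R\<rbrakk> \<Longrightarrow> ideal_residuum R I J <+>\<^bsub>R\<^esub> ideal_residuum R J I = carrier R"

locale BL_ring = MTL_ring +
  assumes divisible: "\<lbrakk>ideal I R; ideal J R\<rbrakk> \<Longrightarrow> I \<inter> J = I \<cdot>\<^bsub>R\<^esub> ideal_residuum R I J"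

end

theory Submission
  imports Defs
begin

text \<open>
  Divisibility is checked locally. At a maximal ideal \<open>M\<close>, prelinearity makes any two principal
  ideals comparable up to a multiplier outside \<open>M\<close>, so a finitely generated ideal \<open>I\<close> is locally
  generated by a single \<open>b \<in> I\<close>: some \<open>s \<notin> M\<close> satisfies \<open>s I \<subseteq> (b)\<close>. If \<open>k \<in> I \<inter> J\<close> and
  \<open>s k = r b\<close>, then \<open>s r I \<subseteq> r (b) = (s k) \<subseteq> J\<close>, so \<open>s r \<in> I \<rightarrow> J\<close> and
  \<open>s\<^sup>2 k = b (s r) \<in> I (I \<rightarrow> J)\<close>. Hence the ideal of all \<open>t\<close> with \<open>t k \<in> I (I \<rightarrow> J)\<close> lies in no
  maximal ideal.
\<close>

lemma mem_ideal_residuum_iff: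
  "x \<in> ideal_residuum R I J \<longleftrightarrow> x \<in> carrier R \<and> (\<forall>i\<in>I. x \<otimes>\<^bsub>R\<^esub> i \<in> J)"
  by (auto simp: ideal_residuum_def l_coset_def)

text \<open>The first argument may be any subset of the carrier: below it is also a singleton
  \<open>{k}\<close>, which gives the ideal of all \<open>t\<close> with
  \<open>t k \<in> J\<close>.\<close>

lemma (in cring) ideal_ideal_residuum:
  assumes "I \<subseteq> carrier R" "ideal J R"
  shows "ideal (ideal_residuum R I J) R"
proof -
  interpret J: ideal J R by fact
  have car: "i \<in> carrier R" if "i \<in> I" for i
    using assms(1) that by blast
  show ?thesis
  proof (rule idealI[OF ring_axioms])
    show "subgroup (ideal_residuum R I J) (add_monoid R)"
    proof (rule add.subgroupI)
      have "\<zero> \<in> ideal_residuum R I J"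
        using car by (simp add: mem_ideal_residuum_iff)
      then show "ideal_residuum R I J \<noteq> {}" by blast
    qed (auto simp: mem_ideal_residuum_iff car l_distr l_minus)
  next
    fix a x assume "a \<in> ideal_residuum R I J" "x \<in> carrier R"
    then show "x \<otimes> a \<in> ideal_residuum R I J"
      by (auto simp: mem_ideal_residuum_iff car m_assoc J.I_l_closed)
    then show "a \<otimes> x \<in> ideal_residuum R I J"
      using \<open>a \<in> _\<close> \<open>x \<in> _\<close> by (simp add: m_comm mem_ideal_residuum_iff)
  qed
qed

text \<open>Zorn's lemma on the proper ideals above \<open>I\<close>.\<close>

lemma (in noetherian_ring) exists_maximalideal_superset:
  assumes "ideal I R" "I \<noteq> carrier R"
  shows "\<exists>M. maximalideal M R \<and> I \<subseteq> M"
proof -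
  define S where "S = {J. ideal J R \<and> I \<subseteq> J \<and> J \<noteq> carrier R}"
  have bounded: "\<exists>U\<in>S. \<forall>K\<in>C. K \<subseteq> U" if "subset.chain S C" for C
  proof (cases "C = {}")
    case True
    then show ?thesis using assms by (auto simp: S_def)
  next
    case False
    \<comment> \<open>By the ascending chain condition the union of a nonempty chain is one of its
      members, so it is again proper and bounds the chain within \<open>S\<close>.\<close>
    have "subset.chain {J. ideal J R} C"
      using that by (auto simp: S_def pred_on.chain_def)
    then have "\<Union>C \<in> C"
      by (rule ideal_chain_is_trivial[OF False])
    then show ?thesis
      using that by (auto simp: pred_on.chain_def)
  qed
  have "\<exists>M\<in>S. \<forall>K\<in>S. M \<subseteq> K \<longrightarrow> K = M"
    by (rule subset_Zorn) (rule bounded)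
  then obtain M where M: "M \<in> S" and max: "\<And>K. K \<in> S \<Longrightarrow> M \<subseteq> K \<Longrightarrow> K = M"
    by blast
  have "maximalideal M R"
    using M max by (intro maximalidealI) (auto simp: S_def)
  with M show ?thesis by (auto simp: S_def)
qed

text \<open>Prelinearity of two principal ideals, read off at \<open>\<one>\<close>. A prime ideal
  cannot contain both \<open>u\<close> and \<open>v\<close>, so one of them is a multiplier that
  compares \<open>a\<close> and \<open>b\<close> locally.\<close>

lemma (in MTL_ring) principal_prelinear:
  assumes "a \<in> carrier R" "b \<in> carrier R"
  shows "\<exists>u\<in>carrier R. \<exists>v\<in>carrier R. u \<oplus> v = \<one> \<and> u \<otimes> a \<in> PIdl b \<and> v \<otimes> b \<in> PIdl a"
proof -
  have "\<one> \<in> ideal_residuum R (PIdl a) (PIdl b) <+>\<^bsub>R\<^esub> ideal_residuum R (PIdl b) (PIdl a)"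
    using prelinear[OF cgenideal_ideal cgenideal_ideal] assms by simp
  then obtain u v where "u \<in> ideal_residuum R (PIdl a) (PIdl b)"
    "v \<in> ideal_residuum R (PIdl b) (PIdl a)" "u \<oplus> v = \<one>"
    by (auto simp: set_add_def')
  then show ?thesis
    using cgenideal_self[OF assms(1)] cgenideal_self[OF assms(2)]
    unfolding mem_ideal_residuum_iff by blast
qed

text \<open>Each new generator \<open>a\<close> is compared with the local generator
  \<open>b\<close> found so far, and the one that locally divides the other is kept. Asking for
  \<open>b\<close> in \<open>Idl A\<close> instead of \<open>A\<close> admits the empty set, with
  \<open>s = \<one>\<close> and \<open>b = \<zero>\<close>.\<close>

lemma (in MTL_ring) locally_principal_generators:
  assumes "primeideal P R" "finite A" "A \<subseteq> carrier R"
  shows "\<exists>s\<in>carrier R - P. \<exists>b\<in>Idl A. \<forall>x\<in>A. s \<otimes> x \<in> PIdl b"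
  using assms(2,3)
proof (induction A rule: finite_induct)
  interpret P: primeideal P R by fact
  case empty
  have "\<one> \<notin> P" using P.I_notcarr P.one_imp_carrier by auto
  moreover have "\<zero> \<in> Idl {}"
    by (simp add: genideal_ideal additive_subgroup.zero_closed ideal.axioms(1))
  ultimately show ?case by blast
next
  interpret P: primeideal P R by fact
  case (insert a A)
  then have a: "a \<in> carrier R" and A: "A \<subseteq> carrier R" by auto
  from insert obtain s b where s: "s \<in> carrier R" "s \<notin> P" and b: "b \<in> Idl A"
    and sA: "\<And>x. x \<in> A \<Longrightarrow> s \<otimes> x \<in> PIdl b" by auto
  have bc: "b \<in> carrier R"
    using ideal.Icarr[OF genideal_ideal[OF A] b] .
  obtain u v where u: "u \<in> carrier R" and v: "v \<in> carrier R" and uv: "u \<oplus> v = \<one>"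
    and ua: "u \<otimes> b \<in> PIdl a" and vb: "v \<otimes> a \<in> PIdl b"
    using principal_prelinear[OF bc a] by blast
  have gen: "insert a A \<subseteq> Idl (insert a A)"
    using a A by (intro genideal_self) auto
  have bgen: "b \<in> Idl (insert a A)"
    using genideal_minimal[of "Idl (insert a A)" A] gen genideal_ideal[of "insert a A"] a A b
    by auto
  interpret a: ideal "PIdl a" R by (rule cgenideal_ideal[OF a])
  interpret b: ideal "PIdl b" R by (rule cgenideal_ideal[OF bc])
  show ?case
  proof (cases "u \<in> P")
    \<comment> \<open>Here \<open>u\<close> is a local unit and \<open>u b \<in> (a)\<close>, so
      \<open>a\<close> becomes the new generator, with multiplier \<open>u s\<close>.\<close>
    case False
    have "u \<otimes> s \<otimes> x \<in> PIdl a" if "x \<in> insert a A" for x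
    proof (cases "x = a")
      case True
      then show ?thesis using u s a cgenideal_self by (simp add: a.I_l_closed)
    next
      case False
      with that have x: "x \<in> A" by simp
      then obtain c where c: "c \<in> carrier R" "s \<otimes> x = c \<otimes> b"
        using sA[OF x] unfolding cgenideal_def by blast
      have "u \<otimes> s \<otimes> x = u \<otimes> (s \<otimes> x)"
        using u s x A by (auto simp: m_assoc)
      also have "\<dots> = c \<otimes> (u \<otimes> b)"
        using c u bc by (simp add: m_lcomm)
      finally show ?thesis using ua c by (simp add: a.I_l_closed)
    qed
    moreover have "u \<otimes> s \<notin> P" using P.I_prime False s u by blast
    ultimately show ?thesis
      using u s gen by (intro bexI[of _ "u \<otimes> s"] bexI[of _ a]) auto
  next
    case True
    \<comment> \<open>Otherwise \<open>\<one> = u \<oplus> v\<close> would lie in \<open>P\<close>.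
      Since \<open>v a \<in> (b)\<close>, the old generator \<open>b\<close> survives, with
      multiplier \<open>v s\<close>.\<close>
    have "v \<notin> P"
      using True uv P.I_notcarr P.one_imp_carrier P.a_closed by metis
    then have "v \<otimes> s \<notin> P" using P.I_prime s v by blast
    moreover have "v \<otimes> s \<otimes> x \<in> PIdl b" if "x \<in> insert a A" for x
    proof (cases "x = a")
      case True
      then have "v \<otimes> s \<otimes> x = s \<otimes> (v \<otimes> a)"
        using v s a by (simp add: m_ac)
      then show ?thesis using vb s by (simp add: b.I_l_closed)
    next
      case False
      with that have x: "x \<in> A" by simp
      then have "v \<otimes> s \<otimes> x = v \<otimes> (s \<otimes> x)"
        using v s A by (auto simp: m_assoc)
      then show ?thesis using sA[OF x] v by (simp add: b.I_l_closed)
    qed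
    ultimately show ?thesis
      using v s bgen by (intro bexI[of _ "v \<otimes> s"] bexI[of _ b]) auto
  qed
qed

lemma (in MTL_ring) locally_principal:
  assumes "primeideal P R" "finite A" "A \<subseteq> carrier R"
  shows "\<exists>s\<in>carrier R - P. \<exists>b\<in>Idl A. \<forall>x\<in>Idl A. s \<otimes> x \<in> PIdl b"
proof -
  obtain s b where s: "s \<in> carrier R - P" and b: "b \<in> Idl A"
    and sA: "\<forall>x\<in>A. s \<otimes> x \<in> PIdl b"
    using locally_principal_generators[OF assms] by blast
  have bc: "b \<in> carrier R"
    using ideal.Icarr[OF genideal_ideal[OF assms(3)] b] .
  \<comment> \<open>The elements that \<open>s\<close> multiplies into \<open>(b)\<close> form an
    ideal, so it contains \<open>Idl A\<close> as soon as it contains \<open>A\<close>.\<close>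
  have "ideal (ideal_residuum R {s} (PIdl b)) R"
    using s bc by (intro ideal_ideal_residuum cgenideal_ideal) auto
  moreover have "A \<subseteq> ideal_residuum R {s} (PIdl b)"
    using sA s assms(3) by (auto simp: mem_ideal_residuum_iff m_comm subset_iff)
  ultimately have "Idl A \<subseteq> ideal_residuum R {s} (PIdl b)"
    by (rule genideal_minimal)
  then have "\<forall>x\<in>Idl A. s \<otimes> x \<in> PIdl b"
    using s by (auto simp: mem_ideal_residuum_iff m_comm subset_iff)
  with s b show ?thesis by blast
qed

text \<open>The noetherian hypothesis supplies finite generators of \<open>I\<close> and the maximal
  ideal at which the argument is localized.\<close>

lemma (in MTL_ring) noetherian_divisible:
  assumes "noetherian_ring R" and I: "ideal I R" and J: "ideal J R"
  shows "I \<inter> J = I \<cdot> ideal_residuum R I J"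
proof
  interpret noetherian_ring R by fact
  interpret I: ideal I R by fact
  interpret J: ideal J R by fact
  have Q: "ideal (ideal_residuum R I J) R"
    using I.a_subset J by (rule ideal_ideal_residuum)
  have W: "ideal (I \<cdot> ideal_residuum R I J) R"
    using I Q by (rule ideal_prod_is_ideal)
  show "I \<cdot> ideal_residuum R I J \<subseteq> I \<inter> J"
  proof
    fix x assume "x \<in> I \<cdot> ideal_residuum R I J"
    then show "x \<in> I \<inter> J"
    proof (induction rule: ideal_prod.induct)
      case (prod i j)
      then have "j \<otimes> i \<in> J" "j \<in> carrier R" by (auto simp: mem_ideal_residuum_iff)
      with prod show ?case by (simp add: I.I_r_closed m_comm)
    qed auto
  qed
  show "I \<inter> J \<subseteq> I \<cdot> ideal_residuum R I J"
  proof
    fix k assume k: "k \<in> I \<inter> J"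
    then have kc: "k \<in> carrier R" by auto
    \<comment> \<open>The multipliers that take \<open>k\<close> into the product; the goal amounts
      to \<open>\<one> \<in> ?T\<close>.\<close>
    let ?T = "ideal_residuum R {k} (I \<cdot> ideal_residuum R I J)"
    have T: "ideal ?T R" using kc W by (intro ideal_ideal_residuum) auto
    have "?T = carrier R"
    proof (rule ccontr)
      assume "?T \<noteq> carrier R"
      then obtain M where M: "maximalideal M R" "?T \<subseteq> M"
        using exists_maximalideal_superset[OF T] by blast
      interpret M: primeideal M R using M(1) by (rule maximalideal_prime)
      obtain A where A: "A \<subseteq> carrier R" "finite A" "I = Idl A"
        using finetely_gen[OF I] by blast
      obtain s b where s: "s \<in> carrier R" "s \<notin> M" and b: "b \<in> I"
        and sI: "\<And>x. x \<in> I \<Longrightarrow> s \<otimes> x \<in> PIdl b"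
        using locally_principal[OF M.primeideal A(2,1)] A(3) by blast
      have bc: "b \<in> carrier R" using b by simp
      obtain r where r: "r \<in> carrier R" "s \<otimes> k = r \<otimes> b"
        using sI k by (auto simp: cgenideal_def)
      \<comment> \<open>Locally \<open>r\<close> is the quotient of \<open>k\<close> by
        \<open>b\<close>, and \<open>b\<close> generates \<open>I\<close>; hence \<open>r\<close>
        carries \<open>I\<close> into \<open>(k)\<close>, and \<open>k \<in> J\<close>.\<close>
      have "s \<otimes> r \<in> ideal_residuum R I J"
        unfolding mem_ideal_residuum_iff
      proof (intro conjI ballI)
        fix i assume i: "i \<in> I"
        then obtain c where c: "c \<in> carrier R" "s \<otimes> i = c \<otimes> b"
          using sI by (auto simp: cgenideal_def)
        have "s \<otimes> r \<otimes> i = r \<otimes> (s \<otimes> i)"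
          using s r i by (simp add: m_ac)
        also have "\<dots> = c \<otimes> (s \<otimes> k)"
          unfolding c(2) r(2) using c r bc by (simp add: m_lcomm)
        finally show "s \<otimes> r \<otimes> i \<in> J"
          using k s c by (simp add: J.I_l_closed)
      qed (use s r in simp)
      then have "b \<otimes> (s \<otimes> r) \<in> I \<cdot> ideal_residuum R I J"
        using b by (rule ideal_prod.prod[rotated])
      moreover have "b \<otimes> (s \<otimes> r) = s \<otimes> (r \<otimes> b)"
        using s r bc by (simp add: m_ac)
      then have "b \<otimes> (s \<otimes> r) = s \<otimes> s \<otimes> k"
        using s kc by (simp add: m_assoc flip: r(2))
      ultimately have "s \<otimes> s \<in> ?T"
        using s by (simp add: mem_ideal_residuum_iff)
      \<comment> \<open>\<open>s \<otimes> s \<in> ?T \<subseteq> M\<close> would force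
        \<open>s \<in> M\<close>, as \<open>M\<close> is prime.\<close>
      then show False using M(2) M.I_prime s by blast
    qed
    then have "\<one> \<in> ?T" by simp
    then show "k \<in> I \<cdot> ideal_residuum R I J"
      using kc by (simp add: mem_ideal_residuum_iff)
  qed
qed

theorem proposition4p8:
  fixes R :: "('a, 'b) ring_scheme"
  assumes "cring R" and "noetherian_ring R"
  shows "MTL_ring R \<longleftrightarrow> BL_ring R"
proof
  assume "MTL_ring R"
  then interpret MTL_ring R .
  show "BL_ring R"
    using noetherian_divisible[OF assms(2)] by unfold_locales
next
  assume "BL_ring R"
  then show "MTL_ring R" by (rule BL_ring.axioms(1))
qed

end
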